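(* Let $c_3\ge 0$ be a constant. Suppose there exists an algorithm for the problem of merging under partial information which, given as partial information any poset $P'$ of width at most $2$, performs at most $c_3\log e(P')$ comparisons. Then there exists an algorithm for the problem of sorting under partial information which, given as partial information any finite poset $P$, performs at most $(9.09+c_3)\log e(P)$ comparisons.
   Context: Sorting under partial information: $V$ is a finite set carrying an unknown linear order $\leqslant$; a poset $P=(V,\leqslant_P)$ whose relations are all relations of $\leqslant$ is given; the algorithm must determine $\leqslant$ using queries ``is $v\leqslant w$?'' (comparisons); the bound on comparisons must hold for every linear order $\leqslant$ extending $\leqslant_P$. Merging under partial information is the special case in which the given poset has width at most $2$ (i.e., its ground set is covered by two chains). $e(P)$ denotes the number of linear extensions of $P$ and $\log$ the binary logarithm. *)

theory Defs
  imports "HOL-Analysis.Analysis"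
begin

text \<open>A poset is a pair of a ground set \<open>V\<close> and a relation \<open>r\<close> with
  \<^term>\<open>partial_order_on V r\<close>; in particular \<open>r\<close> is reflexive on \<open>V\<close> and contained in \<open>V \<times> V\<close>.\<close>

definition linear_extensions :: "'a set \<Rightarrow> 'a rel \<Rightarrow> 'a rel set" where
  "linear_extensions V r = {l. linear_order_on V l \<and> r \<subseteq> l}"

definition num_linear_extensions :: "'a set \<Rightarrow> 'a rel \<Rightarrow> nat" where
  "num_linear_extensions V r = card (linear_extensions V r)"

definition antichain :: "'a set \<Rightarrow> 'a rel \<Rightarrow> 'a set \<Rightarrow> bool" where
  "antichain V r S \<longleftrightarrow> S \<subseteq> V \<and> (\<forall>x\<in>S. \<forall>y\<in>S. (x, y) \<in> r \<longrightarrow> x = y)"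

definition poset_width :: "'a set \<Rightarrow> 'a rel \<Rightarrow> nat" where
  "poset_width V r = Max (card ` {S. antichain V r S})"

text \<open>The behaviour of an adaptive deterministic comparison algorithm on a fixed input poset:
  \<open>Query v w t f\<close> asks ``is \<open>v \<le> w\<close>?'' and continues with \<open>t\<close> on the answer yes and with \<open>f\<close> on
  the answer no; \<open>Output l\<close> stops and announces that the unknown linear order is \<open>l\<close>.\<close>

datatype 'a comparison_tree =
  Output "'a rel"
| Query 'a 'a "'a comparison_tree" "'a comparison_tree"

fun queries_within :: "'a set \<Rightarrow> 'a comparison_tree \<Rightarrow> bool" where
  "queries_within V (Output l) \<longleftrightarrow> True"
| "queries_within V (Query v w t f) \<longleftrightarrow>
     v \<in> V \<and> w \<in> V \<and> queries_within V t \<and> queries_within V f"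

fun run :: "'a rel \<Rightarrow> 'a comparison_tree \<Rightarrow> 'a rel" where
  "run l (Output l') = l'"
| "run l (Query v w t f) = (if (v, w) \<in> l then run l t else run l f)"

fun comparisons :: "'a rel \<Rightarrow> 'a comparison_tree \<Rightarrow> nat" where
  "comparisons l (Output l') = 0"
| "comparisons l (Query v w t f) =
     Suc (if (v, w) \<in> l then comparisons l t else comparisons l f)"

definition sorts :: "'a set \<Rightarrow> 'a rel \<Rightarrow> 'a comparison_tree \<Rightarrow> bool" where
  "sorts V r T \<longleftrightarrow> queries_within V T \<and> (\<forall>l\<in>linear_extensions V r. run l T = l)"

type_synonym 'a comparison_algorithm = "'a set \<Rightarrow> 'a rel \<Rightarrow> 'a comparison_tree"

definition solves_sorting :: "'a comparison_algorithm \<Rightarrow> bool" where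
  "solves_sorting A \<longleftrightarrow> (\<forall>V r. finite V \<and> partial_order_on V r \<longrightarrow> sorts V r (A V r))"

definition solves_merging :: "'a comparison_algorithm \<Rightarrow> bool" where
  "solves_merging A \<longleftrightarrow>
     (\<forall>V r. finite V \<and> partial_order_on V r \<and> poset_width V r \<le> 2 \<longrightarrow> sorts V r (A V r))"

end

theory Submission
  imports Defs
begin

text \<open>Remove a longest chain \<open>A\<close> from \<open>P\<close>, sort the remaining \<open>m\<close> elements \<open>B\<close>, and hand the two chains
  \<open>A\<close> and \<open>B\<close> to the merging algorithm; the poset it receives has at most \<open>e(P)\<close> linear extensions.
  The set \<open>B\<close> is partitioned greedily into longest chains \<open>C\<close>, which are merged pairwise along a binary
  tree with the leaf \<open>C\<close> at depth at most \<open>\<lceil>log (m / |C|)\<rceil>\<close>, so sorting \<open>B\<close> costs at most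
  \<open>\<Sum> |C| log (m / |C|) + m\<close> comparisons. Two bounds turn this into \<open>9 log e(P)\<close>.
  First, \<open>m \<le> log e(P)\<close>: of two distinct minimal elements either one can come first, and a unique minimal
  element can be removed together with one element of every longest chain.
  Second, \<open>e \<ge> m! \<Prod> x\<^sub>v\<close> whenever the weights \<open>x\<close> sum to at most 1 along every chain, which is proved by
  counting strict maps into \<open>{0..N}\<close> and letting \<open>N\<close> tend to infinity. The weights
  \<open>1 / (2 sqrt (m |C|))\<close> for \<open>v\<close> in \<open>C\<close> are admissible, and with \<open>m! \<ge> (m / 4)\<^sup>m\<close> they give
  \<open>\<Sum> |C| log (m / |C|) \<le> 2 log e + 6 m\<close>.\<close>

subsection \<open>Decision trees and merging\<close>

text \<open>\<open>L\<close> is the set of orders still compatible with the answers so far. It is an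
  arbitrary set rather than the extensions of a poset, so that a query simply splits it in
  two.\<close>

definition sortable_within :: "'a set \<Rightarrow> 'a rel set \<Rightarrow> real \<Rightarrow> bool" where
  "sortable_within V L q \<longleftrightarrow>
     (\<exists>T. queries_within V T \<and> (\<forall>l\<in>L. run l T = l \<and> real (comparisons l T) \<le> q))"

text \<open>This encodes that the order on \<open>C\<close> is already known: no candidate in
  \<open>L\<close> disagrees with another about it, so no explicit order has to be carried
  along.\<close>

definition sorted_by_all :: "'a rel set \<Rightarrow> 'a set \<Rightarrow> bool" where
  "sorted_by_all L C \<longleftrightarrow>
     (\<forall>l\<in>L. \<forall>l'\<in>L. \<forall>x\<in>C. \<forall>y\<in>C. (x, y) \<in> l \<longrightarrow> (x, y) \<in> l')"

lemma sortable_within_mono: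
  assumes "sortable_within V L q" "q \<le> q'"
  shows "sortable_within V L q'"
  using assms unfolding sortable_within_def by (meson order_trans)

lemma sortable_within_empty: "sortable_within V {} q"
  unfolding sortable_within_def by (intro exI[of _ "Output {}"]) simp

lemma sortable_within_query:
  assumes "v \<in> V" "w \<in> V"
    and "sortable_within V {l\<in>L. (v, w) \<in> l} q"
    and "sortable_within V {l\<in>L. (v, w) \<notin> l} q"
  shows "sortable_within V L (q + 1)"
proof -
  obtain T where T: "queries_within V T"
    "\<And>l. l \<in> L \<Longrightarrow> (v, w) \<in> l \<Longrightarrow> run l T = l \<and> real (comparisons l T) \<le> q"
    using assms(3) unfolding sortable_within_def by auto
  obtain F where F: "queries_within V F"
    "\<And>l. l \<in> L \<Longrightarrow> (v, w) \<notin> l \<Longrightarrow> run l F = l \<and> real (comparisons l F) \<le> q"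
    using assms(4) unfolding sortable_within_def by auto
  show ?thesis
    unfolding sortable_within_def
    by (rule exI[of _ "Query v w T F"]) (use T F assms(1,2) in auto)
qed

lemma sorted_by_all_subset:
  "sorted_by_all L C \<Longrightarrow> L' \<subseteq> L \<Longrightarrow> C' \<subseteq> C \<Longrightarrow> sorted_by_all L' C'"
  unfolding sorted_by_all_def by blast

lemma linear_order_on_refl: "linear_order_on V l \<Longrightarrow> x \<in> V \<Longrightarrow> (x, x) \<in> l"
  by (auto simp: order_on_defs refl_on_def)

lemma linear_order_on_trans:
  "linear_order_on V l \<Longrightarrow> (x, y) \<in> l \<Longrightarrow> (y, z) \<in> l \<Longrightarrow> (x, z) \<in> l"
  unfolding order_on_defs trans_def by blast

lemma linear_order_on_antisym:
  "linear_order_on V l \<Longrightarrow> (x, y) \<in> l \<Longrightarrow> (y, x) \<in> l \<Longrightarrow> x = y"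
  unfolding order_on_defs antisym_def by blast

lemma linear_order_on_cases:
  "linear_order_on V l \<Longrightarrow> x \<in> V \<Longrightarrow> y \<in> V \<Longrightarrow> (x, y) \<in> l \<or> (y, x) \<in> l"
  by (cases "x = y") (auto simp: order_on_defs refl_on_def total_on_def)

lemma linear_order_on_least:
  assumes "linear_order_on V l" "finite C" "C \<noteq> {}" "C \<subseteq> V"
  obtains c where "c \<in> C" "\<And>x. x \<in> C \<Longrightarrow> (c, x) \<in> l"
proof -
  have "\<exists>c\<in>C. \<forall>x\<in>C. (c, x) \<in> l"
    using assms(2-4)
  proof (induction C rule: finite_ne_induct)
    case (singleton x)
    then show ?case using linear_order_on_refl[OF assms(1)] by auto
  next
    case (insert x F)
    then obtain c where c: "c \<in> F" "\<forall>x\<in>F. (c, x) \<in> l" by auto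
    then have "(c, x) \<in> l \<or> (x, c) \<in> l"
      using linear_order_on_cases[OF assms(1), of c x] c(1) insert.prems by blast
    then show ?case
    proof
      assume "(c, x) \<in> l"
      then show ?thesis using c by auto
    next
      assume "(x, c) \<in> l"
      then have "(x, y) \<in> l" if "y \<in> insert x F" for y
        using that c linear_order_on_trans[OF assms(1)] linear_order_on_refl[OF assms(1), of x]
          insert.prems by blast
      then show ?thesis by blast
    qed
  qed
  then show ?thesis using that by blast
qed

lemma sorted_by_all_insert_least:
  assumes L: "\<And>l. l \<in> L \<Longrightarrow> linear_order_on V l"
    and C: "sorted_by_all L C"
    and c: "\<And>l x. l \<in> L \<Longrightarrow> x \<in> insert c C \<Longrightarrow> (c, x) \<in> l"
  shows "sorted_by_all L (insert c C)"
  unfolding sorted_by_all_def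
proof (intro ballI impI)
  fix l l' x y
  assume *: "l \<in> L" "l' \<in> L" "x \<in> insert c C" "y \<in> insert c C" "(x, y) \<in> l"
  show "(x, y) \<in> l'"
  proof (cases "x = c")
    case True
    then show ?thesis using c * by blast
  next
    case False
    then have "y \<noteq> c" using linear_order_on_antisym[OF L[OF *(1)] *(5)] c[OF *(1,3)] by blast
    then show ?thesis using False * C unfolding sorted_by_all_def by blast
  qed
qed

text \<open>Standard merging in continuation style: \<open>q\<close> pays for whatever follows once
  \<open>C \<union> D\<close> is sorted. One query compares the two least elements, the smaller one
  is set aside, and it is put back as least element when the continuation is invoked.\<close>

lemma merge_within:
  assumes "finite C" "finite D" "C \<subseteq> V" "D \<subseteq> V"
    and "\<And>l. l \<in> L \<Longrightarrow> linear_order_on V l"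
    and "sorted_by_all L C" "sorted_by_all L D"
    and "\<And>L'. L' \<subseteq> L \<Longrightarrow> sorted_by_all L' (C \<union> D) \<Longrightarrow> sortable_within V L' q"
  shows "sortable_within V L (q + real (card C + card D))"
  using assms
proof (induction "card C + card D" arbitrary: C D L rule: less_induct)
  case less
  note lin = less.prems(5)
  show ?case
  proof (cases "C = {} \<or> D = {} \<or> L = {}")
    case True
    then consider "L = {}" | "sorted_by_all L (C \<union> D)" using less.prems(6,7) by auto
    then show ?thesis
    proof cases
      case 1
      then show ?thesis by (simp add: sortable_within_empty)
    next
      case 2
      show ?thesis
        by (rule sortable_within_mono[OF less.prems(8)[OF order_refl 2]]) simp
    qed
  next
    case False
    \<comment> \<open>Any candidate may be used to find the least elements \<open>c\<close> and
      \<open>d\<close>, since all candidates agree on \<open>C\<close> and on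
      \<open>D\<close>.\<close>
    then obtain l0 where l0: "l0 \<in> L" by auto
    obtain c where c: "c \<in> C" "\<And>x. x \<in> C \<Longrightarrow> (c, x) \<in> l0"
      using linear_order_on_least[OF lin[OF l0] less.prems(1) _ less.prems(3)] False by blast
    obtain d where d: "d \<in> D" "\<And>x. x \<in> D \<Longrightarrow> (d, x) \<in> l0"
      using linear_order_on_least[OF lin[OF l0] less.prems(2) _ less.prems(4)] False by blast
    have cl: "(c, x) \<in> l" if "l \<in> L" "x \<in> C" for l x
      using less.prems(6)[unfolded sorted_by_all_def, rule_format, OF l0 that(1) c(1) that(2) c(2)[OF that(2)]] .
    have dl: "(d, x) \<in> l" if "l \<in> L" "x \<in> D" for l x
      using less.prems(7)[unfolded sorted_by_all_def, rule_format, OF l0 that(1) d(1) that(2) d(2)[OF that(2)]] .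
    have cardC: "card C = Suc (card (C - {c}))" and cardD: "card D = Suc (card (D - {d}))"
      using card_Suc_Diff1[OF less.prems(1) c(1)] card_Suc_Diff1[OF less.prems(2) d(1)] by simp_all
    have cV: "c \<in> V" and dV: "d \<in> V" using c d less.prems(3,4) by auto
    let ?q = "q + real (card C + card D - 1)"
    have "sortable_within V {l\<in>L. (c, d) \<in> l} ?q"
    proof -
      have "sortable_within V {l\<in>L. (c, d) \<in> l} (q + real (card (C - {c}) + card D))"
      proof (rule less.hyps)
        show "sorted_by_all {l\<in>L. (c, d) \<in> l} (C - {c})" "sorted_by_all {l\<in>L. (c, d) \<in> l} D"
          using less.prems(6,7) by (auto intro: sorted_by_all_subset)
        fix L' assume L': "L' \<subseteq> {l\<in>L. (c, d) \<in> l}" "sorted_by_all L' ((C - {c}) \<union> D)"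
        have "sorted_by_all L' (insert c ((C - {c}) \<union> D))"
        proof (rule sorted_by_all_insert_least[where V = V])
          fix l x assume *: "l \<in> L'" "x \<in> insert c ((C - {c}) \<union> D)"
          then have l: "l \<in> L" "(c, d) \<in> l" using L' by auto
          show "(c, x) \<in> l"
            using * cl[OF l(1)] linear_order_on_trans[OF lin[OF l(1)] l(2) dl[OF l(1)]] c(1)
            by auto
        qed (use L' lin in auto)
        moreover have "insert c ((C - {c}) \<union> D) = C \<union> D" using c(1) by auto
        ultimately show "sortable_within V L' q" using less.prems(8) L'(1) by auto
      qed (use less.prems(1-5) cardC in auto)
      then show ?thesis using cardC by simp
    qed
    \<comment> \<open>By totality the answer no means that \<open>d\<close> lies below
      \<open>c\<close>, so this case mirrors the previous one.\<close>
    moreover have "sortable_within V {l\<in>L. (c, d) \<notin> l} ?q"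
    proof -
      have "sortable_within V {l\<in>L. (c, d) \<notin> l} (q + real (card C + card (D - {d})))"
      proof (rule less.hyps)
        show "sorted_by_all {l\<in>L. (c, d) \<notin> l} C" "sorted_by_all {l\<in>L. (c, d) \<notin> l} (D - {d})"
          using less.prems(6,7) by (auto intro: sorted_by_all_subset)
        fix L' assume L': "L' \<subseteq> {l\<in>L. (c, d) \<notin> l}" "sorted_by_all L' (C \<union> (D - {d}))"
        have "sorted_by_all L' (insert d (C \<union> (D - {d})))"
        proof (rule sorted_by_all_insert_least[where V = V])
          fix l x assume *: "l \<in> L'" "x \<in> insert d (C \<union> (D - {d}))"
          then have l: "l \<in> L" "(d, c) \<in> l"
            using L' linear_order_on_cases[OF lin cV dV] by auto
          show "(d, x) \<in> l"
            using * dl[OF l(1)] linear_order_on_trans[OF lin[OF l(1)] l(2) cl[OF l(1)]] d(1)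
            by auto
        qed (use L' lin in auto)
        moreover have "insert d (C \<union> (D - {d})) = C \<union> D" using d(1) by auto
        ultimately show "sortable_within V L' q" using less.prems(8) L'(1) by auto
      qed (use less.prems(1-5) cardD in auto)
      then show ?thesis using cardD by simp
    qed
    ultimately have "sortable_within V L (?q + 1)" by (rule sortable_within_query[OF cV dV])
    then show ?thesis using cardC by (simp add: algebra_simps)
  qed
qed

text \<open>Only the deepest level of the merge tree is inspected: two chains on it are merged and moved
  one level up, and a single chain on it can be moved up without violating Kraft's inequality,
  because all other summands are even multiples of the smallest one.\<close>

lemma kraft_merge_within:
  fixes C :: "'i \<Rightarrow> 'a set" and d :: "'i \<Rightarrow> nat"
  assumes "finite I" and "\<And>i. i \<in> I \<Longrightarrow> finite (C i) \<and> C i \<subseteq> V \<and> sorted_by_all L (C i)"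
    and "(\<Sum>i\<in>I. (1/2::real) ^ d i) \<le> 1"
    and "\<And>l. l \<in> L \<Longrightarrow> linear_order_on V l"
    and "\<And>L'. L' \<subseteq> L \<Longrightarrow> sorted_by_all L' (\<Union>i\<in>I. C i) \<Longrightarrow> sortable_within V L' q"
  shows "sortable_within V L (q + (\<Sum>i\<in>I. real (card (C i) * d i)))"
  using assms
proof (induction "\<Sum>i\<in>I. d i" arbitrary: I C d L q rule: less_induct)
  case less
  note fin = less.prems(1) and C = less.prems(2) and kraft = less.prems(3)
    and lin = less.prems(4) and cont = less.prems(5)
  show ?case
  proof (cases "\<forall>i\<in>I. d i = 0")
    case True
    \<comment> \<open>Each index of depth 0 contributes 1 to Kraft's sum, so at most one chain is
      left and nothing remains to be merged.\<close>
    then have "real (card I) \<le> 1" using kraft by simp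
    then have "card I \<le> 1" by linarith
    then consider "I = {}" | i where "I = {i}" using fin by (metis One_nat_def card_1_singletonE card_eq_0_iff le_Suc_eq le_zero_eq)
    then have "sorted_by_all L (\<Union>i\<in>I. C i)"
    proof cases
      case 1
      then show ?thesis by (simp add: sorted_by_all_def)
    next
      case 2
      then show ?thesis using C by simp
    qed
    then show ?thesis using cont[OF order_refl] True by simp
  next
    case False
    define m where "m = Max (d ` I)"
    have "m \<in> d ` I" unfolding m_def using False fin by (intro Max_in) auto
    then obtain i where i: "i \<in> I" "d i = m" by auto
    have le: "d j \<le> m" if "j \<in> I" for j using that fin by (simp add: m_def)
    have "m \<noteq> 0" using False le by fastforce
    then obtain k where k: "m = Suc k" using not0_implies_Suc by blast
    have sum_i: "sum g I = g i + sum g (I - {i})" for g :: "'i \<Rightarrow> real"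
      using fin i(1) by (simp add: sum.remove)
    have sum_i': "sum g I = g i + sum g (I - {i})" for g :: "'i \<Rightarrow> nat"
      using fin i(1) by (simp add: sum.remove)
    show ?thesis
    proof (cases "\<exists>j\<in>I - {i}. d j = m")
      case True
      then obtain j where j: "j \<in> I - {i}" "d j = m" by auto
      let ?J = "I - {i} - {j}"
      \<comment> \<open>The merged chain takes the index \<open>i\<close> at depth
        \<open>k = m - 1\<close>, and \<open>j\<close> disappears. Two terms
        \<open>(1/2) ^ Suc k\<close> become one term \<open>(1/2) ^ k\<close>, so Kraft's sum is
        unchanged, while the cost of the merge is the one level that both chains have
        climbed.\<close>
      let ?C = "C(i := C i \<union> C j)" and ?d = "d(i := k)"
      have sum_ij: "sum g I = g i + (g j + sum g ?J)" for g :: "'i \<Rightarrow> real"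
        unfolding sum_i using fin j(1) by (subst sum.remove[of "I - {i}" j]) auto
      have sum_ij': "sum g I = g i + (g j + sum g ?J)" for g :: "'i \<Rightarrow> nat"
        unfolding sum_i' using fin j(1) by (subst sum.remove[of "I - {i}" j]) auto
      have I: "I - {j} = insert i ?J" "i \<notin> ?J" "finite ?J" using i j fin by auto
      have sum_J: "sum g (I - {j}) = g i + sum g ?J" for g :: "'i \<Rightarrow> real"
        using I by simp
      have sum_J': "sum g (I - {j}) = g i + sum g ?J" for g :: "'i \<Rightarrow> nat"
        using I by simp
      have "sortable_within V L
          (q + (\<Sum>i\<in>?J. real (card (C i) * d i)) + real (card (C i) + card (C j)) * real k
            + real (card (C i) + card (C j)))"
      proof (rule merge_within)
        show "finite (C i)" "finite (C j)" "C i \<subseteq> V" "C j \<subseteq> V"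
          "sorted_by_all L (C i)" "sorted_by_all L (C j)" using C i j by auto
        fix L' assume L': "L' \<subseteq> L" "sorted_by_all L' (C i \<union> C j)"
        have "sortable_within V L' (q + (\<Sum>i\<in>I - {j}. real (card (?C i) * ?d i)))"
        proof (rule less.hyps)
          show "sum ?d (I - {j}) < sum d I"
            unfolding sum_J' sum_ij' using i j k by simp
          show "(\<Sum>i\<in>I - {j}. (1/2::real) ^ ?d i) \<le> 1"
            using kraft unfolding sum_J sum_ij using i j k by simp
          have un: "(\<Union>i\<in>I - {j}. ?C i) = (\<Union>i\<in>I. C i)" using i j by (auto split: if_splits)
          show "sortable_within V L'' q" if "L'' \<subseteq> L'" "sorted_by_all L'' (\<Union>i\<in>I - {j}. ?C i)"
            for L'' using that L' cont unfolding un by blast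
          show "finite (?C x) \<and> ?C x \<subseteq> V \<and> sorted_by_all L' (?C x)" if "x \<in> I - {j}" for x
            using that C[of x] C[of i] C[of j] i j L' by (auto intro: sorted_by_all_subset)
        qed (use fin lin L' in auto)
        then have "sortable_within V L' (q + (real (card (C i \<union> C j) * k)
                                         + (\<Sum>i\<in>?J. real (card (C i) * d i))))"
          unfolding sum_J by simp
        moreover have "real (card (C i \<union> C j) * k) \<le> real (card (C i) + card (C j)) * real k"
          unfolding of_nat_mult by (intro mult_right_mono) (auto intro: card_Un_le simp flip: of_nat_add)
        ultimately show "sortable_within V L'
            (q + (\<Sum>i\<in>?J. real (card (C i) * d i)) + real (card (C i) + card (C j)) * real k)"
          by (elim sortable_within_mono) simp
      qed (use lin in auto)
      then show ?thesis
        unfolding sum_ij using i j k by (simp add: algebra_simps)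
    next
      case False
      then have lt: "d j \<le> k" if "j \<in> I - {i}" for j using le[of j] that k by force
      let ?d = "d(i := k)"
      have upd: "sum (\<lambda>x. g x (?d x)) (I - {i}) = sum (\<lambda>x. g x (d x)) (I - {i})"
        for g :: "'i \<Rightarrow> nat \<Rightarrow> 'b::comm_monoid_add"
        by (rule sum.cong) auto
      \<comment> \<open>\<open>S\<close> is the integer numerator of the remaining Kraft sum over
        the denominator \<open>2 ^ k\<close>.\<close>
      define S where "S = (\<Sum>j\<in>I - {i}. 2 ^ (k - d j) :: nat)"
      have S: "(\<Sum>j\<in>I - {i}. (1/2::real) ^ d j) = real S * (1/2) ^ k"
        unfolding S_def of_nat_sum sum_distrib_right
      proof (rule sum.cong)
        fix j assume "j \<in> I - {i}"
        then have "(2::real) ^ k = 2 ^ (k - d j) * 2 ^ d j" using lt by (simp flip: power_add)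
        then show "(1/2::real) ^ d j = real (2 ^ (k - d j)) * (1/2) ^ k"
          by (simp add: power_one_over field_simps)
      qed simp
      have "real S * (1/2)^k + (1/2)^Suc k \<le> 1"
        using kraft sum_i[of "\<lambda>j. (1/2) ^ d j"] S i(2) k by simp
      then have "2 * real S + 1 \<le> 2 ^ Suc k" by (simp add: field_simps)
      \<comment> \<open>The left side is odd and the right side even, so there is room for one more
        unit. This is what lifting \<open>i\<close> to depth \<open>k\<close> requires.\<close>
      then have "2 * S + 1 \<le> 2 ^ Suc k" using of_nat_le_iff[where 'a=real, of "2 * S + 1" "2 ^ Suc k"] by simp
      then have "S + 1 \<le> 2 ^ k" by simp
      then have "real S + 1 \<le> 2 ^ k" using of_nat_le_iff[where 'a=real, of "S + 1" "2 ^ k"] by simp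
      then have Sk: "real S * (1/2)^k + (1/2)^k \<le> 1" by (simp add: field_simps)
      have "sortable_within V L (q + (\<Sum>i\<in>I. real (card (C i) * ?d i)))"
      proof (rule less.hyps)
        show "sum ?d I < sum d I"
          unfolding sum_i' upd[of "\<lambda>x y. y"] using i k by simp
        show "(\<Sum>i\<in>I. (1/2::real) ^ ?d i) \<le> 1"
          unfolding sum_i upd[of "\<lambda>x y. (1/2) ^ y"] S using Sk by simp
      qed (use less.prems in auto)
      then show ?thesis
      proof (rule sortable_within_mono)
        show "q + (\<Sum>i\<in>I. real (card (C i) * ?d i)) \<le> q + (\<Sum>i\<in>I. real (card (C i) * d i))"
          by (intro add_left_mono sum_mono) (use i k in \<open>auto intro: mult_left_mono\<close>)
      qed
    qed
  qed
qed

subsection \<open>Linear extensions\<close>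

lemma finite_linear_extensions: "finite V \<Longrightarrow> finite (linear_extensions V r)"
  by (rule finite_subset[of _ "Pow (V \<times> V)"])
    (auto simp: linear_extensions_def order_on_defs)

lemma partial_order_on_restrict:
  "partial_order_on V r \<Longrightarrow> W \<subseteq> V \<Longrightarrow> partial_order_on W (r \<inter> W \<times> W)"
  unfolding order_on_defs
  by (auto simp: refl_on_def intro!: transI antisymI dest: transD antisymD)

lemma num_linear_extensions_antimono:
  assumes "finite V" "r \<subseteq> r'"
  shows "num_linear_extensions V r' \<le> num_linear_extensions V r"
  unfolding num_linear_extensions_def
  by (rule card_mono[OF finite_linear_extensions[OF assms(1)]])
    (use assms(2) in \<open>auto simp: linear_extensions_def\<close>)

text \<open>The new element goes directly above the \<open>l\<close>-down-closure of its predecessors.\<close>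

definition insert_element :: "'a set \<Rightarrow> 'a rel \<Rightarrow> 'a \<Rightarrow> 'a rel \<Rightarrow> 'a rel" where
  "insert_element V r v l =
     (let D = {u \<in> V - {v}. \<exists>p \<in> V - {v}. (p, v) \<in> r \<and> (u, p) \<in> l}
      in l \<union> D \<times> {v} \<union> {v} \<times> (V - D))"

text \<open>The second claim makes the insertion injective in \<open>l\<close>, as restriction
  undoes it. In the third claim \<open>v\<close> is minimal, so the set \<open>D\<close> of elements
  placed below \<open>v\<close> is empty and \<open>v\<close> becomes the least element.\<close>

lemma insert_element_linear_extension:
  assumes r: "partial_order_on V r" and v: "v \<in> V"
    and l: "l \<in> linear_extensions (V - {v}) (r \<inter> (V - {v}) \<times> (V - {v}))"
  shows "insert_element V r v l \<in> linear_extensions V r"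
    and "insert_element V r v l \<inter> (V - {v}) \<times> (V - {v}) = l"
    and "(\<And>u. (u, v) \<in> r \<Longrightarrow> u = v) \<Longrightarrow> u \<in> V \<Longrightarrow> (v, u) \<in> insert_element V r v l"
proof -
  define W where "W = V - {v}"
  define D where "D = {u \<in> W. \<exists>p \<in> W. (p, v) \<in> r \<and> (u, p) \<in> l}"
  have ins: "insert_element V r v l = l \<union> D \<times> {v} \<union> {v} \<times> (V - D)"
    unfolding insert_element_def Let_def D_def W_def by simp
  have lin: "linear_order_on W l" and ext: "r \<inter> W \<times> W \<subseteq> l"
    using l unfolding linear_extensions_def W_def by auto
  have V: "V = insert v W" "v \<notin> W" using v unfolding W_def by auto
  have lW: "l \<subseteq> W \<times> W" and lrefl: "\<And>x. x \<in> W \<Longrightarrow> (x, x) \<in> l"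
    and ltrans: "\<And>x y z. (x, y) \<in> l \<Longrightarrow> (y, z) \<in> l \<Longrightarrow> (x, z) \<in> l"
    and lanti: "\<And>x y. (x, y) \<in> l \<Longrightarrow> (y, x) \<in> l \<Longrightarrow> x = y"
    and ltot: "\<And>x y. x \<in> W \<Longrightarrow> y \<in> W \<Longrightarrow> x \<noteq> y \<Longrightarrow> (x, y) \<in> l \<or> (y, x) \<in> l"
    using lin unfolding order_on_defs refl_on_def trans_def antisym_def total_on_def by blast+
  have rV: "r \<subseteq> V \<times> V"
    and rtrans: "\<And>x y z. (x, y) \<in> r \<Longrightarrow> (y, z) \<in> r \<Longrightarrow> (x, z) \<in> r"
    and ranti: "\<And>x y. (x, y) \<in> r \<Longrightarrow> (y, x) \<in> r \<Longrightarrow> x = y"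
    using r by (simp_all add: order_on_defs) (meson transD antisymD)+
  have DW: "D \<subseteq> W" unfolding D_def by auto
  have Ddown: "u \<in> D" if "u' \<in> D" "(u, u') \<in> l" for u u'
    using that lW ltrans unfolding D_def by blast
  have Dbelow: "u \<in> D" if "(u, v) \<in> r" "u \<noteq> v" for u
    using that rV V lrefl unfolding D_def by blast
  \<comment> \<open>An element of \<open>D\<close> above \<open>v\<close> would lie below a
    predecessor \<open>p\<close> of \<open>v\<close> in \<open>l\<close> and above \<open>p\<close>
    in \<open>r\<close>, hence equal \<open>p\<close>, contradicting antisymmetry of
    \<open>r\<close>.\<close>
  have Dabove: "u \<notin> D" if "(v, u) \<in> r" for u
  proof
    assume "u \<in> D"
    then obtain p where p: "p \<in> W" "(p, v) \<in> r" "(u, p) \<in> l" "u \<in> W" unfolding D_def by auto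
    then have "(p, u) \<in> l" using rtrans that ext by blast
    then have "p = u" using lanti p by blast
    then show False using ranti p that V by blast
  qed
  show "insert_element V r v l \<inter> (V - {v}) \<times> (V - {v}) = l"
    unfolding ins W_def[symmetric] using lW DW V by blast
  show "(v, u) \<in> insert_element V r v l" if "\<And>u. (u, v) \<in> r \<Longrightarrow> u = v" "u \<in> V"
    using that V unfolding ins D_def by blast
  let ?k = "l \<union> D \<times> {v} \<union> {v} \<times> (V - D)"
  have "?k \<subseteq> V \<times> V" using lW DW V by blast
  moreover have "refl_on V ?k" unfolding refl_on_def using lrefl V DW by blast
  moreover have "trans ?k"
  proof (rule transI)
    fix x y z assume xy: "(x, y) \<in> ?k" and yz: "(y, z) \<in> ?k"
    have Dl: "(d, w) \<in> l" if "d \<in> D" "w \<in> W" "w \<notin> D" for d w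
      using that ltot Ddown DW by blast
    consider "(x, y) \<in> l" | "x \<in> D" "y = v" | "x = v" "y \<in> V - D" using xy by blast
    then show "(x, z) \<in> ?k"
    proof cases
      case 1
      then have "y \<noteq> v" "x \<in> W" using lW V by auto
      then have "(y, z) \<in> l \<or> y \<in> D \<and> z = v" using yz by blast
      then show ?thesis using 1 ltrans Ddown by blast
    next
      case 2
      then have "z \<in> V - D" using yz lW V DW by blast
      then show ?thesis using 2 Dl V by blast
    next
      case 3
      then have "z = v \<or> z \<in> V - D" using yz Ddown lW V DW by blast
      then show ?thesis using 3 V DW by blast
    qed
  qed
  moreover have "antisym ?k"
    unfolding antisym_def using lanti lW V(2) DW by blast
  moreover have "total_on V ?k"
    unfolding total_on_def using ltot V by blast
  moreover have "r \<subseteq> ?k" using rV V ext Dbelow Dabove by blast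
  ultimately show "insert_element V r v l \<in> linear_extensions V r"
    unfolding ins linear_extensions_def order_on_defs by blast
qed

lemma num_linear_extensions_remove_le:
  assumes "finite V" "partial_order_on V r" "v \<in> V"
  shows "num_linear_extensions (V - {v}) (r \<inter> (V - {v}) \<times> (V - {v})) \<le> num_linear_extensions V r"
  unfolding num_linear_extensions_def
proof (rule card_inj_on_le)
  show "inj_on (insert_element V r v) (linear_extensions (V - {v}) (r \<inter> (V - {v}) \<times> (V - {v})))"
    by (rule inj_onI) (metis insert_element_linear_extension(2)[OF assms(2,3)])
  show "finite (linear_extensions V r)" by (rule finite_linear_extensions[OF assms(1)])
qed (use insert_element_linear_extension(1)[OF assms(2,3)] in auto)

lemma num_linear_extensions_restrict_le:
  assumes "finite V" "partial_order_on V r" "W \<subseteq> V"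
  shows "num_linear_extensions W (r \<inter> W \<times> W) \<le> num_linear_extensions V r"
  using assms
proof (induction "card (V - W)" arbitrary: V r)
  case 0
  then have "V = W" by auto
  moreover have "r \<inter> V \<times> V = r" using 0 unfolding order_on_defs by blast
  ultimately show ?case by simp
next
  case (Suc n)
  then obtain v where v: "v \<in> V" "v \<notin> W"
    by (metis Diff_eq_empty_iff card.empty nat.distinct(1) subsetI)
  let ?U = "V - {v}"
  have "num_linear_extensions W ((r \<inter> ?U \<times> ?U) \<inter> W \<times> W) \<le> num_linear_extensions ?U (r \<inter> ?U \<times> ?U)"
  proof (rule Suc.hyps(1))
    have "?U - W = (V - W) - {v}" by auto
    then show "n = card (?U - W)" using Suc.hyps(2) v Suc.prems(1) by simp
  qed (use Suc.prems v partial_order_on_restrict[OF Suc.prems(2), of ?U] in auto)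
  also have "\<dots> \<le> num_linear_extensions V r"
    by (rule num_linear_extensions_remove_le[OF Suc.prems(1,2) v(1)])
  also have "(r \<inter> ?U \<times> ?U) \<inter> W \<times> W = r \<inter> W \<times> W" using Suc.prems(3) v by auto
  finally show ?case .
qed

section \<open>Exponential lower bound from the longest chain\<close>

text \<open>Inserting a minimal element puts it first, so the extensions obtained by reinserting
  \<open>u\<close> and those obtained by reinserting \<open>v\<close> are disjoint families.\<close>

lemma num_linear_extensions_remove_minimal_add_le:
  assumes "finite V" "partial_order_on V r" "u \<in> V" "v \<in> V" "u \<noteq> v"
    and "\<And>x. (x, u) \<in> r \<Longrightarrow> x = u" "\<And>x. (x, v) \<in> r \<Longrightarrow> x = v"
  shows "num_linear_extensions (V - {u}) (r \<inter> (V - {u}) \<times> (V - {u}))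
       + num_linear_extensions (V - {v}) (r \<inter> (V - {v}) \<times> (V - {v})) \<le> num_linear_extensions V r"
proof -
  let ?E = "\<lambda>w. linear_extensions (V - {w}) (r \<inter> (V - {w}) \<times> (V - {w}))"
  let ?I = "\<lambda>w. insert_element V r w ` ?E w"
  have card: "card (?I w) = card (?E w)" if "w \<in> V" for w
    by (rule card_image, rule inj_onI) (metis insert_element_linear_extension(2)[OF assms(2) that])
  have sub: "?I w \<subseteq> linear_extensions V r" if "w \<in> V" for w
    using insert_element_linear_extension(1)[OF assms(2) that] by auto
  have least: "(w, x) \<in> l" if "l \<in> ?I w" "w \<in> V" "\<And>x. (x, w) \<in> r \<Longrightarrow> x = w" "x \<in> V" for l w x
    using that(1) insert_element_linear_extension(3)[OF assms(2) that(2) _ that(3,4)] by auto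
  have "?I u \<inter> ?I v = {}"
  proof (rule ccontr)
    assume "?I u \<inter> ?I v \<noteq> {}"
    then obtain l where l: "l \<in> ?I u" "l \<in> ?I v" by blast
    then have "(u, v) \<in> l" "(v, u) \<in> l" using least assms by blast+
    moreover have "antisym l" using sub[OF assms(3)] l(1)
      unfolding linear_extensions_def order_on_defs by blast
    ultimately show False using assms(5) unfolding antisym_def by blast
  qed
  moreover have "finite (?I w)" if "w \<in> V" for w
    by (rule finite_subset[OF sub[OF that] finite_linear_extensions[OF assms(1)]])
  ultimately have "card (?I u) + card (?I v) = card (?I u \<union> ?I v)"
    using assms(3,4) by (intro card_Un_disjoint[symmetric]) auto
  also have "\<dots> \<le> card (linear_extensions V r)"
    by (rule card_mono[OF finite_linear_extensions[OF assms(1)]]) (use sub assms(3,4) in blast)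
  finally show ?thesis unfolding num_linear_extensions_def card[OF assms(3)] card[OF assms(4)] .
qed

lemma partial_order_on_minimal_below:
  assumes "finite V" "partial_order_on V r" "x \<in> V"
  obtains u where "(u, x) \<in> r" "\<And>y. (y, u) \<in> r \<Longrightarrow> y = u"
proof -
  have r: "r \<subseteq> V \<times> V" "(x, x) \<in> r"
    "\<And>x y z. (x, y) \<in> r \<Longrightarrow> (y, z) \<in> r \<Longrightarrow> (x, z) \<in> r"
    using assms(2,3) by (simp_all add: order_on_defs refl_on_def) (meson transD)
  have wf: "wf (r - Id)"
    by (rule partial_order_on_well_order_on[OF _ assms(2)])
      (use assms(1) r(1) in \<open>meson finite_SigmaI finite_subset\<close>)
  have "x \<in> {u. (u, x) \<in> r}" using r(2) by simp
  from wfE_min[OF wf this] obtain u where u: "(u, x) \<in> r"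
    "\<And>y. (y, u) \<in> r - Id \<Longrightarrow> (y, x) \<notin> r"
    by auto
  show ?thesis
  proof (rule that[OF u(1)])
    show "y = u" if "(y, u) \<in> r" for y
      using u(2)[of y] that r(3)[OF that u(1)] by blast
  qed
qed

text \<open>Induction on the size of \<open>V\<close>. With two minimal elements, removing either
  one lowers the exponent by at most 1, and the two counts add up. With a single minimal element,
  its removal lowers both \<open>card V\<close> and the chain bound \<open>c\<close>, so the
  exponent stays the same.\<close>

lemma two_power_le_num_linear_extensions:
  assumes "finite V" "partial_order_on V r"
    and "\<And>C. C \<in> Chains r \<Longrightarrow> card C \<le> c"
  shows "2 ^ (card V - c) \<le> num_linear_extensions V r"
  using assms
proof (induction "card V" arbitrary: V r c)
  case 0
  then have "V = {}" by simp
  moreover have "r = {}" using 0 \<open>V = {}\<close> unfolding order_on_defs by blast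
  ultimately have "linear_extensions V r = {{}}"
    unfolding linear_extensions_def by (auto simp: order_on_defs refl_on_def)
  then show ?case using \<open>V = {}\<close> by (simp add: num_linear_extensions_def)
next
  case (Suc n)
  let ?R = "\<lambda>v. r \<inter> (V - {v}) \<times> (V - {v})"
  have r: "r \<subseteq> V \<times> V" "\<And>x. x \<in> V \<Longrightarrow> (x, x) \<in> r"
    using Suc.prems(2) unfolding order_on_defs refl_on_def by blast+
  obtain x where "x \<in> V" using Suc.hyps(2) by fastforce
  obtain u where ux: "(u, x) \<in> r" and min: "\<And>y. (y, u) \<in> r \<Longrightarrow> y = u"
    using partial_order_on_minimal_below[OF Suc.prems(1,2) \<open>x \<in> V\<close>] by metis
  have u: "u \<in> V" "\<And>y. (y, u) \<in> r \<Longrightarrow> y = u" using ux r(1) min by auto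
  have IH: "2 ^ (card (V - {v}) - c') \<le> num_linear_extensions (V - {v}) (?R v)"
    if "v \<in> V" "\<And>C. C \<in> Chains (?R v) \<Longrightarrow> card C \<le> c'" for v c'
  proof (rule Suc.hyps(1))
    show "partial_order_on (V - {v}) (?R v)"
      by (rule partial_order_on_restrict[OF Suc.prems(2)]) simp
    show "n = card (V - {v})" using Suc.hyps(2) Suc.prems(1) that(1) by simp
    show "finite (V - {v})" using Suc.prems(1) by simp
  qed (rule that(2))
  have chain: "card C \<le> c" if "C \<in> Chains (?R v)" for v C
    using Suc.prems(3) that mono_Chains[of "?R v" r] by blast
  show ?case
  proof (cases "\<exists>v\<in>V. v \<noteq> u \<and> (\<forall>y. (y, v) \<in> r \<longrightarrow> y = v)")
    case True
    then obtain v where v: "v \<in> V" "v \<noteq> u" "\<And>y. (y, v) \<in> r \<Longrightarrow> y = v" by blast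
    have "(2::nat) ^ (card V - c) \<le> 2 ^ Suc (n - c)"
      by (rule power_increasing) (use Suc.hyps(2) in auto)
    also have "\<dots> = 2 ^ (n - c) + 2 ^ (n - c)" by simp
    also have "\<dots> \<le> num_linear_extensions (V - {u}) (?R u) + num_linear_extensions (V - {v}) (?R v)"
      using IH[OF u(1) chain[of _ u]] IH[OF v(1) chain[of _ v]] u(1) v(1) Suc.hyps(2)[symmetric] Suc.prems(1)
      by (intro add_mono) simp_all
    also have "\<dots> \<le> num_linear_extensions V r"
      by (rule num_linear_extensions_remove_minimal_add_le[OF Suc.prems(1,2) u(1) v(1) v(2)[symmetric] u(2) v(3)])
    finally show ?thesis .
  next
    case False
    \<comment> \<open>Below every \<open>y\<close> there is a minimal element, and \<open>u\<close>
      is the only one.\<close>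
    have least: "(u, y) \<in> r" if y: "y \<in> V" for y
    proof -
      obtain w where "(w, y) \<in> r" "\<And>z. (z, w) \<in> r \<Longrightarrow> z = w"
        using partial_order_on_minimal_below[OF Suc.prems(1,2) y] by metis
      moreover from this have "w \<in> V" using r(1) by auto
      ultimately have "w = u" using False by auto
      with \<open>(w, y) \<in> r\<close> show ?thesis by simp
    qed
    have c: "card C \<le> c - 1" if C: "C \<in> Chains (?R u)" for C
    proof -
      have CV: "C \<subseteq> V - {u}" using C unfolding Chains_def by blast
      then have "insert u C \<in> Chains r"
        using C least u(1) unfolding Chains_def by blast
      then have "card (insert u C) \<le> c" by (rule Suc.prems(3))
      moreover have "finite C" "u \<notin> C" using CV Suc.prems(1) by (auto intro: finite_subset)
      ultimately show ?thesis by simp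
    qed
    \<comment> \<open>This gives \<open>c \<ge> 1\<close>, so that the subtraction
      \<open>c - 1\<close> is not truncated.\<close>
    have "{u} \<in> Chains r" using r u unfolding Chains_def by auto
    from Suc.prems(3)[OF this] have "c \<ge> 1" by simp
    then have "(2::nat) ^ (card V - c) = 2 ^ (card (V - {u}) - (c - 1))"
      using u(1) Suc.prems(1) by simp
    also have "\<dots> \<le> num_linear_extensions (V - {u}) (?R u)" by (rule IH[OF u(1) c])
    also have "\<dots> \<le> num_linear_extensions V r"
      by (rule num_linear_extensions_remove_le[OF Suc.prems(1,2) u(1)])
    finally show ?thesis .
  qed
qed

section \<open>Weighted lower bound by counting strict maps\<close>

text \<open>Its cardinality is the strict order polynomial of the poset at \<open>N\<close>. Maps
  are extensional, so that they are determined by their values on \<open>V\<close>.\<close>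

definition strict_maps :: "'a set \<Rightarrow> 'a rel \<Rightarrow> nat \<Rightarrow> ('a \<Rightarrow> nat) set" where
  "strict_maps V r N =
     {F \<in> V \<rightarrow>\<^sub>E {..<N}. \<forall>u v. (u, v) \<in> r \<and> u \<noteq> v \<longrightarrow> F u < F v}"

text \<open>Ties of a strict map are broken by an enumeration of \<open>V\<close>; adding to \<open>F\<close> the rank in the
  resulting linear extension makes it injective, so \<open>F\<close> can be recovered from that extension
  together with the image.\<close>

lemma card_strict_maps_le:
  assumes "finite V" "partial_order_on V r"
  shows "card (strict_maps V r N) * fact (card V) \<le> num_linear_extensions V r * (N + card V) ^ card V"
proof -
  obtain idx :: "'a \<Rightarrow> nat" where idx: "inj_on idx V"
    using finite_imp_inj_to_nat_seg[OF assms(1)] by auto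
  define lex where "lex F = {(u, v). u \<in> V \<and> v \<in> V \<and> (F u < F v \<or> F u = F v \<and> idx u \<le> idx v)}"
    for F :: "'a \<Rightarrow> nat"
  define rank where "rank l v = card {u. (u, v) \<in> l \<and> u \<noteq> v}" for l and v :: 'a
  define G where "G F v = F v + rank (lex F) v" for F v
  define S where "S = {..<N + card V}"
  have rV: "r \<subseteq> V \<times> V" using assms(2) by (simp add: order_on_defs)
  have lex: "lex F \<in> linear_extensions V r" if "F \<in> strict_maps V r N" for F
  proof -
    have "antisym (lex F)"
      by (rule antisymI) (auto simp: lex_def intro: inj_onD[OF idx])
    moreover have "trans (lex F)" by (rule transI) (auto simp: lex_def)
    moreover have "total_on V (lex F)" "refl_on V (lex F)" "lex F \<subseteq> V \<times> V"
      by (auto simp: lex_def total_on_def refl_on_def)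
    moreover have "r \<subseteq> lex F"
    proof
      fix p assume p: "p \<in> r"
      obtain u v where uv: "p = (u, v)" "u \<in> V" "v \<in> V" using p rV by auto
      show "p \<in> lex F"
        using that p uv by (cases "u = v") (auto simp: strict_maps_def lex_def)
    qed
    ultimately show ?thesis by (simp add: linear_extensions_def order_on_defs)
  qed
  have down: "{u. (u, v) \<in> lex F \<and> u \<noteq> v} \<subseteq> V - {v}" for F v by (auto simp: lex_def)
  have G_lex: "G F u < G F v" if uv: "(u, v) \<in> lex F" "u \<noteq> v" for F u v
  proof -
    have "{w. (w, u) \<in> lex F \<and> w \<noteq> u} \<subset> {w. (w, v) \<in> lex F \<and> w \<noteq> v}"
    proof
      show "{w. (w, u) \<in> lex F \<and> w \<noteq> u} \<subseteq> {w. (w, v) \<in> lex F \<and> w \<noteq> v}"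
        using uv inj_onD[OF idx, of u v] by (auto simp: lex_def)
      show "{w. (w, u) \<in> lex F \<and> w \<noteq> u} \<noteq> {w. (w, v) \<in> lex F \<and> w \<noteq> v}"
        using uv by auto
    qed
    then have "rank (lex F) u < rank (lex F) v"
      unfolding rank_def by (rule psubset_card_mono[rotated])
        (use down[of v F] assms(1) in \<open>auto intro: finite_subset\<close>)
    moreover have "F u \<le> F v" using uv by (auto simp: lex_def)
    ultimately show ?thesis by (simp add: G_def)
  qed
  have lex_cases: "(u, v) \<in> lex F \<or> (v, u) \<in> lex F" if "u \<in> V" "v \<in> V" for F u v
    using that by (auto simp: lex_def)
  have G_inj: "inj_on (G F) V" for F
  proof (rule inj_onI)
    fix u v assume "u \<in> V" "v \<in> V" "G F u = G F v"
    then show "u = v" using lex_cases[of u v F] G_lex[of u v F] G_lex[of v u F] by auto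
  qed
  \<comment> \<open>The image of \<open>G F\<close> together with the rank of \<open>v\<close>
    determines \<open>G F v\<close>: it is the element of the image with exactly that many smaller
    ones.\<close>
  have rank_G: "rank (lex F) v = card {x \<in> G F ` V. x < G F v}" if v: "v \<in> V" for F v
  proof -
    have "{x \<in> G F ` V. x < G F v} = G F ` {u. (u, v) \<in> lex F \<and> u \<noteq> v}"
    proof (intro equalityI subsetI)
      fix x assume "x \<in> {x \<in> G F ` V. x < G F v}"
      then obtain u where u: "x = G F u" "u \<in> V" "G F u < G F v" by auto
      then have "u \<noteq> v" "(v, u) \<notin> lex F" using G_lex[of v u F] by auto
      then show "x \<in> G F ` {u. (u, v) \<in> lex F \<and> u \<noteq> v}" using u lex_cases[of u v F] v by auto
    next
      fix x assume "x \<in> G F ` {u. (u, v) \<in> lex F \<and> u \<noteq> v}"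
      then show "x \<in> {x \<in> G F ` V. x < G F v}" using G_lex[of _ v F] down[of v F] by auto
    qed
    moreover have "card (G F ` {u. (u, v) \<in> lex F \<and> u \<noteq> v}) = rank (lex F) v"
      unfolding rank_def
      by (rule card_image, rule inj_on_subset[OF G_inj]) (use down[of v F] in auto)
    ultimately show ?thesis by simp
  qed
  have G_bound: "G F v \<in> S" if "F \<in> strict_maps V r N" "v \<in> V" for F v
  proof -
    have "rank (lex F) v \<le> card (V - {v})"
      unfolding rank_def by (rule card_mono[OF _ down]) (use assms(1) in simp)
    also have "\<dots> < card V" using that(2) assms(1) by (metis card_Diff1_less)
    finally show ?thesis using that by (auto simp: S_def G_def strict_maps_def PiE_def Pi_def intro: add_strict_mono)
  qed
  \<comment> \<open>The strict maps are encoded injectively by a linear extension and a subset of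
    \<open>S\<close> of size \<open>card V\<close>. Counting the subsets yields the binomial
    coefficient used below.\<close>
  let ?T = "linear_extensions V r \<times> {B. B \<subseteq> S \<and> card B = card V}"
  have "card (strict_maps V r N) \<le> card ?T"
  proof (rule card_inj_on_le)
    show "inj_on (\<lambda>F. (lex F, G F ` V)) (strict_maps V r N)"
    proof (rule inj_onI)
      fix F F' assume F: "F \<in> strict_maps V r N" "F' \<in> strict_maps V r N"
        and eq: "(lex F, G F ` V) = (lex F', G F' ` V)"
      have "F v = F' v" if v: "v \<in> V" for v
      proof -
        let ?B = "G F ` V"
        have eq_card: "card {x \<in> ?B. x < G F v} = card {x \<in> ?B. x < G F' v}"
          using rank_G[OF v, of F] rank_G[OF v, of F'] eq by simp
        have B: "finite ?B" "G F v \<in> ?B" "G F' v \<in> ?B" using assms(1) v eq by auto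
        have "card {x \<in> ?B. x < a} < card {x \<in> ?B. x < b}" if "a \<in> ?B" "a < b" for a b
          by (rule psubset_card_mono) (use B that in auto)
        from this[of "G F v" "G F' v"] this[of "G F' v" "G F v"] eq_card
        have "G F v = G F' v" using B by (cases "G F v" "G F' v" rule: linorder_cases) auto
        then show ?thesis using eq by (simp add: G_def)
      qed
      then show "F = F'" using F by (auto simp: strict_maps_def intro: PiE_ext)
    qed
    show "finite ?T" using finite_linear_extensions[OF assms(1)] by (auto simp: S_def)
    show "(\<lambda>F. (lex F, G F ` V)) ` strict_maps V r N \<subseteq> ?T"
      using lex G_bound card_image[OF G_inj] by auto
  qed
  also have "\<dots> = num_linear_extensions V r * (N + card V choose card V)"
    by (simp add: card_cartesian_product num_linear_extensions_def n_subsets S_def)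
  finally have "card (strict_maps V r N) * fact (card V)
      \<le> num_linear_extensions V r * ((N + card V choose card V) * fact (card V))"
    by (simp add: mult_le_mono1 flip: mult.assoc)
  also have "\<dots> \<le> num_linear_extensions V r * (N + card V) ^ card V"
    by (rule mult_le_mono2[OF binomial_fact_pow])
  finally show ?thesis .
qed

text \<open>The discrete version of Stanley's map from the chain polytope to the order polytope.\<close>

lemma prod_le_card_strict_maps:
  assumes "finite V" "partial_order_on V r"
    and k: "\<And>C. C \<in> Chains r \<Longrightarrow> sum k C \<le> N"
  shows "(\<Prod>v\<in>V. k v) \<le> card (strict_maps V r (Suc N))"
proof -
  have rV: "r \<subseteq> V \<times> V" and refl: "\<And>x. x \<in> V \<Longrightarrow> (x, x) \<in> r"
    and trans: "\<And>x y z. (x, y) \<in> r \<Longrightarrow> (y, z) \<in> r \<Longrightarrow> (x, z) \<in> r"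
    and anti: "\<And>x y. (x, y) \<in> r \<Longrightarrow> (y, x) \<in> r \<Longrightarrow> x = y"
    using assms(2) by (simp_all add: order_on_defs refl_on_def) (meson transD antisymD)+
  define B where "B v = {C \<in> Chains r. C \<subseteq> {u. (u, v) \<in> r \<and> u \<noteq> v}}" for v
  \<comment> \<open>\<open>H f v\<close> is the largest \<open>f\<close>-weight of a chain with top
    element \<open>v\<close>.\<close>
  define H where "H f v = f v + Max (sum f ` B v)" for f :: "'a \<Rightarrow> nat" and v
  define \<Phi> where "\<Phi> f = restrict (H f) V" for f
  \<comment> \<open>The box has as many points as the product on the left. Its coordinates start at
    1, which makes \<open>H f\<close> strictly increasing.\<close>
  define X where "X = (\<Pi>\<^sub>E v\<in>V. {1..k v})"
  have B_fin: "finite (B v)" for v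
    by (rule finite_subset[of _ "Pow V"]) (use rV assms(1) in \<open>auto simp: B_def\<close>)
  have B_ne: "{} \<in> B v" for v by (simp add: B_def Chains_def)
  have C_fin: "finite C" if "C \<in> B v" for C v
    by (rule finite_subset[OF _ assms(1)]) (use that rV in \<open>auto simp: B_def\<close>)
  have extend: "insert v C \<in> Chains r" if "C \<in> B v" "v \<in> V" for C v
    using that refl by (auto simp: B_def Chains_def)
  have attained: "\<exists>C \<in> B v. H f v = sum f (insert v C)" for f v
  proof -
    have "Max (sum f ` B v) \<in> sum f ` B v"
      using B_fin B_ne by (intro Max_in) auto
    then obtain C where C: "C \<in> B v" "Max (sum f ` B v) = sum f C" by auto
    moreover have "v \<notin> C" using C(1) by (auto simp: B_def)
    ultimately show ?thesis using C_fin[OF C(1)] by (intro bexI[of _ C]) (simp_all add: H_def)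
  qed
  have "\<Phi> f \<in> strict_maps V r (Suc N)" if f: "f \<in> X" for f
  proof -
    have "H f v \<le> N" if v: "v \<in> V" for v
    proof -
      obtain C where C: "C \<in> B v" "H f v = sum f (insert v C)" using attained by blast
      have "sum f (insert v C) \<le> sum k (insert v C)"
        by (rule sum_mono) (use f v C(1) rV in \<open>auto simp: X_def B_def PiE_def Pi_def\<close>)
      also have "\<dots> \<le> N" by (rule k[OF extend[OF C(1) v]])
      finally show ?thesis using C(2) by simp
    qed
    moreover have "H f u < H f v" if uv: "(u, v) \<in> r" "u \<noteq> v" for u v
    proof -
      have V: "u \<in> V" "v \<in> V" using uv rV by auto
      obtain C where C: "C \<in> B u" "H f u = sum f (insert u C)" using attained by blast
      have "insert u C \<subseteq> {w. (w, v) \<in> r \<and> w \<noteq> v}"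
        using C(1) uv trans anti unfolding B_def by blast
      then have "insert u C \<in> B v" using extend[OF C(1) V(1)] by (simp add: B_def)
      then have "H f u \<le> Max (sum f ` B v)" unfolding C(2) using B_fin by (intro Max_ge) auto
      moreover have "f v \<ge> 1" using f V(2) by (auto simp: X_def PiE_def Pi_def)
      ultimately show ?thesis by (simp add: H_def)
    qed
    ultimately show ?thesis
      using rV by (auto simp: strict_maps_def \<Phi>_def less_Suc_eq_le subset_iff)
  qed
  \<comment> \<open>The map is inverted from the bottom up: once \<open>f\<close> is known strictly
    below \<open>v\<close>, the maximum in \<open>H f v\<close> is known and can be
    subtracted.\<close>
  moreover have "inj_on \<Phi> X"
  proof (rule inj_onI)
    fix f g assume fg: "f \<in> X" "g \<in> X" and eq: "\<Phi> f = \<Phi> g"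
    have "f v = g v" if "v \<in> V" for v
      using that
    proof (induction "card {u. (u, v) \<in> r}" arbitrary: v rule: less_induct)
      case less
      have below: "f u = g u" if u: "(u, v) \<in> r" "u \<noteq> v" for u
      proof (rule less.hyps)
        show "u \<in> V" using u rV by auto
        have fin: "finite {w. (w, v) \<in> r}"
          by (rule finite_subset[OF _ assms(1)]) (use rV in auto)
        have "v \<in> {w. (w, v) \<in> r}" "v \<notin> {w. (w, u) \<in> r}" using refl less.prems anti u by auto
        moreover have "{w. (w, u) \<in> r} \<subseteq> {w. (w, v) \<in> r}" using trans u by auto
        ultimately show "card {w. (w, u) \<in> r} < card {w. (w, v) \<in> r}"
          by (intro psubset_card_mono[OF fin]) auto
      qed
      have "sum f C = sum g C" if "C \<in> B v" for C
        by (rule sum.cong) (use that below in \<open>auto simp: B_def\<close>)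
      then have "sum f ` B v = sum g ` B v" by (intro image_cong) auto
      moreover have "H f v = H g v" using fun_cong[OF eq, of v] less.prems by (simp add: \<Phi>_def)
      ultimately show ?case by (simp add: H_def)
    qed
    then show "f = g" using fg unfolding X_def by (auto intro: PiE_ext)
  qed
  moreover have "finite (strict_maps V r (Suc N))"
    by (rule finite_subset[of _ "V \<rightarrow>\<^sub>E {..<Suc N}"])
      (use assms(1) in \<open>auto simp: strict_maps_def intro: finite_PiE\<close>)
  ultimately have "card X \<le> card (strict_maps V r (Suc N))" by (intro card_inj_on_le) auto
  then show ?thesis using assms(1) by (simp add: X_def card_PiE)
qed

text \<open>Rounding \<open>x v * N\<close> down gives integer weights with chain sums at most
  \<open>N\<close>. The two counting lemmas then bound their product, and after division by
  \<open>N ^ card V\<close> the rounding and the shift by \<open>card V + 1\<close> vanish in the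
  limit.\<close>

lemma fact_mult_prod_le_num_linear_extensions:
  fixes x :: "'a \<Rightarrow> real"
  assumes "finite V" "partial_order_on V r"
    and x0: "\<And>v. v \<in> V \<Longrightarrow> 0 \<le> x v"
    and x: "\<And>C. C \<in> Chains r \<Longrightarrow> sum x C \<le> 1"
  shows "fact (card V) * (\<Prod>v\<in>V. x v) \<le> real (num_linear_extensions V r)"
proof -
  let ?n = "card V" and ?e = "num_linear_extensions V r"
  define k where "k N v = nat \<lfloor>x v * real N\<rfloor>" for N v
  have CV: "C \<subseteq> V" if "C \<in> Chains r" for C
    using that assms(2) by (auto simp: Chains_def order_on_defs)
  have k_le: "real (k N v) \<le> x v * real N" if "v \<in> V" for N v
    using x0[OF that] by (simp add: k_def)
  have bound: "(\<Prod>v\<in>V. real (k N v) / real N) * fact ?n \<le> real ?e * ((real N + 1 + ?n) / N) ^ ?n"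
    if N: "N > 0" for N
  proof -
    have "(\<Prod>v\<in>V. k N v) \<le> card (strict_maps V r (Suc N))"
    proof (rule prod_le_card_strict_maps[OF assms(1,2)])
      fix C assume C: "C \<in> Chains r"
      have "real (sum (k N) C) \<le> (\<Sum>v\<in>C. x v * real N)"
        unfolding of_nat_sum by (rule sum_mono) (use CV[OF C] k_le in auto)
      also have "\<dots> \<le> 1 * real N"
        unfolding sum_distrib_right[symmetric] by (rule mult_right_mono[OF x[OF C]]) simp
      finally have "real (sum (k N) C) \<le> real N" by simp
      then show "sum (k N) C \<le> N" by (simp only: of_nat_le_iff)
    qed
    then have "(\<Prod>v\<in>V. k N v) * fact ?n \<le> card (strict_maps V r (Suc N)) * fact ?n"
      by simp
    also have "\<dots> \<le> ?e * (Suc N + ?n) ^ ?n" by (rule card_strict_maps_le[OF assms(1,2)])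
    finally have "real ((\<Prod>v\<in>V. k N v) * fact ?n) \<le> real (?e * (Suc N + ?n) ^ ?n)"
      by (simp only: of_nat_le_iff)
    then have "(\<Prod>v\<in>V. real (k N v)) * fact ?n \<le> real ?e * (real N + 1 + ?n) ^ ?n"
      by (simp add: algebra_simps)
    then have "(\<Prod>v\<in>V. real (k N v)) * fact ?n / real N ^ ?n \<le> real ?e * (real N + 1 + ?n) ^ ?n / real N ^ ?n"
      by (rule divide_right_mono) simp
    then show ?thesis by (simp add: prod_dividef power_divide)
  qed
  have lim: "(\<lambda>N. real (k N v) / real N) \<longlonglongrightarrow> x v" if "v \<in> V" for v
  proof (rule tendsto_sandwich)
    show "\<forall>\<^sub>F N in sequentially. x v - 1 / real N \<le> real (k N v) / real N"
    proof (rule eventually_mono[OF eventually_gt_at_top[of 0]])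
      fix N :: nat assume N: "N > 0"
      have "x v * real N - 1 \<le> real (k N v)" unfolding k_def by linarith
      then have "(x v * real N - 1) / real N \<le> real (k N v) / real N"
        by (rule divide_right_mono) simp
      then show "x v - 1 / real N \<le> real (k N v) / real N" using N by (simp add: diff_divide_distrib)
    qed
    show "\<forall>\<^sub>F N in sequentially. real (k N v) / real N \<le> x v"
    proof (rule eventually_mono[OF eventually_gt_at_top[of 0]])
      fix N :: nat assume "N > 0"
      then show "real (k N v) / real N \<le> x v" using k_le[OF that, of N] by (simp add: field_simps)
    qed
    show "(\<lambda>N. x v - 1 / real N) \<longlonglongrightarrow> x v"
      using tendsto_diff[OF tendsto_const lim_1_over_n] by simp
  qed simp
  have "(\<lambda>N. 1 + (1 + real ?n) * (1 / real N)) \<longlonglongrightarrow> 1 + (1 + real ?n) * 0"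
    by (intro tendsto_intros lim_1_over_n)
  moreover have "\<forall>\<^sub>F N in sequentially. 1 + (1 + real ?n) * (1 / real N) = (real N + 1 + ?n) / N"
    by (rule eventually_mono[OF eventually_gt_at_top[of 0]]) (simp add: field_simps)
  ultimately have "(\<lambda>N. (real N + 1 + ?n) / N) \<longlonglongrightarrow> 1"
    by (simp add: tendsto_cong)
  then have rhs: "(\<lambda>N. real ?e * ((real N + 1 + ?n) / N) ^ ?n) \<longlonglongrightarrow> real ?e * 1 ^ ?n"
    by (intro tendsto_intros)
  have lhs: "(\<lambda>N. (\<Prod>v\<in>V. real (k N v) / real N) * fact ?n) \<longlonglongrightarrow> (\<Prod>v\<in>V. x v) * fact ?n"
    by (intro tendsto_mult tendsto_prod tendsto_const lim)
  have "(\<Prod>v\<in>V. x v) * fact ?n \<le> real ?e * 1 ^ ?n"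
    by (rule LIMSEQ_le[OF lhs rhs]) (use bound in \<open>auto intro!: exI[of _ 1]\<close>)
  then show ?thesis by (simp add: mult.commute)
qed

subsection \<open>Greedy chain partitions\<close>

text \<open>For the last property let \<open>C\<close> be the first block chosen. If
  \<open>card C \<le> t\<close>, then \<open>D\<close> is no longer than the longest chain
  \<open>C\<close>; otherwise \<open>D\<close> avoids \<open>C\<close> and induction applies to the
  remaining blocks.\<close>

lemma greedy_chain_partition:
  assumes "finite W" "\<And>x. x \<in> W \<Longrightarrow> (x, x) \<in> r"
  shows "\<exists>P. partition_on W P \<and> P \<subseteq> Chains r \<and>
           (\<forall>D\<in>Chains r. \<forall>t. D \<subseteq> \<Union>{C\<in>P. card C \<le> t} \<longrightarrow> card D \<le> t)"
  using assms
proof (induction "card W" arbitrary: W rule: less_induct)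
  case less
  show ?case
  proof (cases "W = {}")
    case True
    then show ?thesis by (intro exI[of _ "{}"]) (auto simp: partition_on_def)
  next
    case False
    let ?S = "{C \<in> Chains r. C \<subseteq> W}"
    have fin: "finite ?S" by (rule finite_subset[of _ "Pow W"]) (use less.prems(1) in auto)
    have "{} \<in> ?S" by (simp add: Chains_def)
    then have "Max (card ` ?S) \<in> card ` ?S" using fin by (intro Max_in) auto
    then obtain C where C: "C \<in> ?S" "Max (card ` ?S) = card C" by auto
    have longest: "card D \<le> card C" if "D \<in> Chains r" "D \<subseteq> W" for D
      unfolding C(2)[symmetric] by (rule Max_ge) (use that fin in auto)
    obtain x where x: "x \<in> W" using False by auto
    then have "card {x} \<le> card C" using less.prems(2) by (intro longest) (auto simp: Chains_def)
    then have ne: "C \<noteq> {}" by auto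
    have "card (W - C) < card W"
      by (rule psubset_card_mono[OF less.prems(1)]) (use C ne in auto)
    then obtain P where P: "partition_on (W - C) P" "P \<subseteq> Chains r"
      "\<And>D t. D \<in> Chains r \<Longrightarrow> D \<subseteq> \<Union>{C\<in>P. card C \<le> t} \<Longrightarrow> card D \<le> t"
      using less.hyps[of "W - C"] less.prems by auto
    have "partition_on (C \<union> (W - C)) (insert C P)"
      using P(1) ne by (intro partition_on_insert[THEN iffD2]) (auto simp: partition_on_def disjnt_def)
    moreover have "C \<union> (W - C) = W" using C(1) by auto
    moreover have "card D \<le> t" if D: "D \<in> Chains r" "D \<subseteq> \<Union>{C'\<in>insert C P. card C' \<le> t}" for D t
    proof (cases "card C \<le> t")
      case True
      have "D \<subseteq> W" using D(2) C(1) P(1) by (auto simp: partition_on_def)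
      then show ?thesis using longest[OF D(1)] True by simp
    next
      case False
      then have "D \<subseteq> \<Union>{C\<in>P. card C \<le> t}" using D(2) by auto
      then show ?thesis by (rule P(3)[OF D(1)])
    qed
    ultimately show ?thesis using C(1) P(2) by (intro exI[of _ "insert C P"]) auto
  qed
qed

text \<open>The \<open>j\<close>-th smallest value of \<open>s\<close> is at least \<open>j\<close>,
  so the sum is at most that of \<open>1 / sqrt j\<close>. The induction removes an element with the
  largest value.\<close>

lemma sum_inverse_sqrt_le:
  assumes "finite D" "\<And>v. v \<in> D \<Longrightarrow> s v > 0"
    and "\<And>t. card {v\<in>D. s v \<le> t} \<le> t"
  shows "(\<Sum>v\<in>D. 1 / sqrt (real (s v))) \<le> 2 * sqrt (real (card D))"
  using assms
proof (induction "card D" arbitrary: D)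
  case 0
  then show ?case by simp
next
  case (Suc n)
  have "Max (s ` D) \<in> s ` D" using Suc by (intro Max_in) auto
  then obtain v where v: "v \<in> D" "s v = Max (s ` D)" by auto
  then have "{u\<in>D. s u \<le> s v} = D" using Suc.prems(1) by auto
  then have sv: "Suc n \<le> s v" using Suc.prems(3)[of "s v"] Suc.hyps(2) by simp
  have card: "card (D - {v}) = n" using v(1) Suc.hyps(2) Suc.prems(1) by simp
  have "(\<Sum>v\<in>D. 1 / sqrt (real (s v))) = 1 / sqrt (real (s v)) + (\<Sum>v\<in>D - {v}. 1 / sqrt (real (s v)))"
    using v(1) Suc.prems(1) by (simp add: sum.remove)
  also have "(\<Sum>v\<in>D - {v}. 1 / sqrt (real (s v))) \<le> 2 * sqrt (real n)"
    unfolding card[symmetric]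
  proof (rule Suc.hyps(1))
    show "card {u \<in> D - {v}. s u \<le> t} \<le> t" for t
      by (rule order_trans[OF card_mono Suc.prems(3)[of t]]) (use Suc.prems(1) in auto)
  qed (use card Suc.prems in auto)
  also have "1 / sqrt (real (s v)) \<le> 1 / sqrt (real (Suc n))"
    using sv by (intro divide_left_mono) auto
  also have "1 / sqrt (real (Suc n)) + 2 * sqrt (real n) \<le> 2 * sqrt (real (Suc n))"
  proof -
    define a b where "a = sqrt (real (Suc n))" and "b = sqrt (real n)"
    have ab: "a > 0" "a * a = b * b + 1" by (auto simp: a_def b_def)
    \<comment> \<open>Since \<open>a * a = b * b + 1\<close>, this square equals
      \<open>2 * a * a - 2 * a * b - 1\<close>.\<close>
    have "0 \<le> (a - b)\<^sup>2" by simp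
    then have "1 + 2 * b * a \<le> 2 * a * a" using ab(2) by (simp add: power2_eq_square algebra_simps)
    then have "1 / a + 2 * b \<le> 2 * a" using ab(1) by (simp add: field_simps)
    then show ?thesis by (simp add: a_def b_def)
  qed
  finally show ?case using Suc.hyps(2) by simp
qed

text \<open>A weak form of Stirling's bound, from \<open>(1 + 1/n) ^ n \<le> exp 1\<close>. The base
  4 has binary logarithm exactly 2.\<close>

lemma power_le_four_power_mult_fact: "real n ^ n \<le> 4 ^ n * fact n"
proof (induction n)
  case (Suc n)
  have "real (Suc n) ^ n \<le> 4 * real n ^ n"
  proof (cases "n = 0")
    case False
    have "(1 + 1 / real n) ^ n \<le> exp 1"
      using exp_ge_one_plus_x_over_n_power_n[of n 1] False by simp
    also have "\<dots> \<le> 4" using exp_le by simp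
    finally have "(1 + 1 / real n) ^ n * real n ^ n \<le> 4 * real n ^ n" by (rule mult_right_mono) simp
    moreover have "(1 + 1 / real n) ^ n * real n ^ n = real (Suc n) ^ n"
      using False by (simp add: field_simps flip: power_mult_distrib)
    ultimately show ?thesis by simp
  qed simp
  also have "\<dots> \<le> 4 * (4 ^ n * fact n)" using Suc.IH by simp
  finally have "real (Suc n) * real (Suc n) ^ n \<le> real (Suc n) * (4 * (4 ^ n * fact n))"
    by (rule mult_left_mono) simp
  then show ?case by (simp add: algebra_simps)
qed simp

lemma log_prod:
  fixes b :: real
  assumes "finite I" "\<And>i. i \<in> I \<Longrightarrow> f i \<noteq> 0"
  shows "log b (\<Prod>i\<in>I. f i) = (\<Sum>i\<in>I. log b (f i))"
  using assms by (simp add: log_def ln_prod sum_divide_distrib)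

text \<open>A chain has at most \<open>t\<close> elements in blocks of size at most \<open>t\<close>, so the weights
  \<open>1 / (2 sqrt (card W * card C))\<close> of the elements of the blocks \<open>C\<close> sum to at most 1 along it.\<close>

lemma greedy_entropy_le:
  assumes W: "finite W" "partial_order_on W r"
    and P: "partition_on W P" "P \<subseteq> Chains r"
    and greedy: "\<And>D t. D \<in> Chains r \<Longrightarrow> D \<subseteq> \<Union>{C\<in>P. card C \<le> t} \<Longrightarrow> card D \<le> t"
  shows "(\<Sum>C\<in>P. real (card C) * log 2 (card W / card C))
           \<le> 2 * log 2 (num_linear_extensions W r) + 6 * card W"
proof (cases "W = {}")
  case True
  then have "P = {}" using P(1) by (auto simp: partition_on_def)
  moreover have "card C \<le> 0" if "C \<in> Chains r" for C
    using that True W(2) by (auto simp: Chains_def order_on_defs)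
  \<comment> \<open>This makes the logarithm on the right nonnegative.\<close>
  then have "num_linear_extensions W r \<ge> 1"
    using two_power_le_num_linear_extensions[OF W, of 0] True by simp
  ultimately show ?thesis using True by simp
next
  case False
  define n where "n = card W"
  have n: "n > 0" using False W(1) by (simp add: n_def card_gt_0_iff)
  have finP: "finite P" by (rule finite_elements[OF W(1) P(1)])
  have Un: "\<Union>P = W" using P(1) by (simp add: partition_on_def)
  have finC: "finite C" if "C \<in> P" for C using that Un W(1) by (auto intro: finite_subset)
  have "\<forall>v\<in>W. \<exists>C. C \<in> P \<and> v \<in> C" using Un by auto
  then obtain b where b: "\<And>v. v \<in> W \<Longrightarrow> b v \<in> P \<and> v \<in> b v" by metis
  have b_eq: "b v = C" if "C \<in> P" "v \<in> C" for v C
    using that b[of v] Un partition_onD2[OF P(1)] by (auto simp: disjoint_def)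
  define s where "s v = card (b v)" for v
  have s: "s v > 0" if "v \<in> W" for v
    using b[OF that] finC[of "b v"] by (auto simp: s_def card_gt_0_iff)
  define x where "x v = 1 / (2 * sqrt (real n * real (s v)))" for v
  have x0: "x v > 0" if "v \<in> W" for v using n s[OF that] by (simp add: x_def)
  have "sum x D \<le> 1" if D: "D \<in> Chains r" for D
  proof -
    have DW: "D \<subseteq> W" using D W(2) by (auto simp: Chains_def order_on_defs)
    have finD: "finite D" by (rule finite_subset[OF DW W(1)])
    have "(\<Sum>v\<in>D. 1 / sqrt (real (s v))) \<le> 2 * sqrt (real (card D))"
    proof (rule sum_inverse_sqrt_le[OF finD])
      show "card {v \<in> D. s v \<le> t} \<le> t" for t
      proof (rule greedy)
        show "{v \<in> D. s v \<le> t} \<in> Chains r" using D by (auto simp: Chains_def)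
        show "{v \<in> D. s v \<le> t} \<subseteq> \<Union>{C\<in>P. card C \<le> t}" using b DW by (auto simp: s_def)
      qed
    qed (use s DW in auto)
    also have "\<dots> \<le> 2 * sqrt (real n)"
      using card_mono[OF W(1) DW] by (simp add: n_def)
    finally have "(\<Sum>v\<in>D. 1 / sqrt (real (s v))) / (2 * sqrt (real n)) \<le> 1"
      using n by simp
    moreover have "sum x D = (\<Sum>v\<in>D. 1 / sqrt (real (s v))) / (2 * sqrt (real n))"
      unfolding sum_divide_distrib by (rule sum.cong) (simp_all add: x_def real_sqrt_mult mult_ac)
    ultimately show ?thesis by simp
  qed
  then have e: "fact n * (\<Prod>v\<in>W. x v) \<le> real (num_linear_extensions W r)"
    unfolding n_def using x0 by (intro fact_mult_prod_le_num_linear_extensions[OF W]) (auto intro: less_imp_le)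
  have pos: "fact n * (\<Prod>v\<in>W. x v) > 0" using x0 by (simp add: prod_pos)
  have log_e: "log 2 (fact n * (\<Prod>v\<in>W. x v)) \<le> log 2 (num_linear_extensions W r)"
    using pos e by (intro log_le_cancel_iff[THEN iffD2]) auto
  have log_sqrt: "log 2 (sqrt y) = log 2 y / 2" if "y > 0" for y :: real
    using that by (simp add: log_def ln_sqrt)
  have log_x: "log 2 (x v) = - 1 - (log 2 n + log 2 (s v)) / 2" if "v \<in> W" for v
    using n s[OF that] by (simp add: x_def log_divide log_mult log_sqrt)
  have "log 2 (real n ^ n) \<le> log 2 (4 ^ n * fact n)"
    using power_le_four_power_mult_fact[of n] n by (intro log_le_cancel_iff[THEN iffD2]) auto
  moreover have "log 2 (4::real) = 2" using log_pow_cancel[of 2 2] by simp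
  ultimately have fact: "n * log 2 n - 2 * n \<le> log 2 (fact n)"
    using n by (simp add: log_nat_power log_mult)
  have "(\<Sum>C\<in>P. real (card C) * log 2 (n / card C)) = (\<Sum>C\<in>P. \<Sum>v\<in>C. log 2 (n / s v))"
    by (rule sum.cong) (auto simp: s_def b_eq)
  also have "\<dots> = (\<Sum>v\<in>W. log 2 (n / s v))"
    unfolding Un[symmetric] using finC partition_onD2[OF P(1)]
    by (intro sum.Union_disjoint[symmetric, unfolded comp_def]) (auto simp: disjoint_def)
  also have "\<dots> = (\<Sum>v\<in>W. log 2 n - log 2 (s v))"
    by (rule sum.cong) (use n s in \<open>auto simp: log_divide\<close>)
  \<comment> \<open>Solving \<open>log_x\<close> for \<open>log 2 (s v)\<close> expresses each
    summand through the weight \<open>x v\<close>.\<close>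
  also have "\<dots> = (\<Sum>v\<in>W. 2 * log 2 (x v) + (2 * log 2 n + 2))"
    by (rule sum.cong) (simp_all add: log_x add_divide_distrib)
  also have "\<dots> = 2 * (\<Sum>v\<in>W. log 2 (x v)) + n * (2 * log 2 n + 2)"
    by (simp add: sum.distrib sum_distrib_left n_def)
  also have "(\<Sum>v\<in>W. log 2 (x v)) = log 2 (\<Prod>v\<in>W. x v)"
    using W(1) x0 by (intro log_prod[symmetric]) (auto simp: less_imp_neq[symmetric])
  also have "\<dots> = log 2 (fact n * (\<Prod>v\<in>W. x v)) - log 2 (fact n)"
    using prod_pos[of W x] x0 by (subst log_mult) auto
  \<comment> \<open>The bound \<open>fact\<close> replaces \<open>- 2 * log 2 (fact n)\<close> by
    \<open>4 * n - 2 * n * log 2 n\<close>; with the extra \<open>2 * n\<close> this gives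
    \<open>6 * n\<close>.\<close>
  also have "2 * (log 2 (fact n * (\<Prod>v\<in>W. x v)) - log 2 (fact n)) + n * (2 * log 2 n + 2)
      \<le> 2 * log 2 (num_linear_extensions W r) + 6 * n"
    using fact log_e by (simp add: algebra_simps)
  finally show ?thesis by (simp add: n_def)
qed

subsection \<open>Sorting\<close>

lemma sorted_by_all_Chains:
  assumes "C \<in> Chains r" "L \<subseteq> linear_extensions V r"
  shows "sorted_by_all L C"
  unfolding sorted_by_all_def
proof (intro ballI impI)
  fix l l' x y assume *: "l \<in> L" "l' \<in> L" "x \<in> C" "y \<in> C" "(x, y) \<in> l"
  have "r \<subseteq> l" "r \<subseteq> l'" "antisym l"
    using *(1,2) assms(2) by (auto simp: linear_extensions_def order_on_defs)
  moreover have "(x, y) \<in> r \<or> (y, x) \<in> r"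
    using *(3,4) assms(1) by (auto simp: Chains_def)
  moreover have "(x, x) \<in> r" using *(3) assms(1) by (auto simp: Chains_def)
  ultimately show "(x, y) \<in> l'" using antisymD[of l x y] *(5) by auto
qed

text \<open>An antichain meets each of the two chains in at most one element.\<close>

lemma poset_width_le_2:
  assumes "finite V" "A \<in> Chains r" "B \<in> Chains r" "V \<subseteq> A \<union> B"
  shows "poset_width V r \<le> 2"
proof -
  have "card S \<le> 2" if S: "antichain V r S" for S
  proof -
    have S': "S \<subseteq> V" "\<And>x y. x \<in> S \<Longrightarrow> y \<in> S \<Longrightarrow> (x, y) \<in> r \<Longrightarrow> x = y"
      using S by (auto simp: antichain_def)
    have fin: "finite S" using S'(1) assms(1) by (rule finite_subset)
    have le1: "card (S \<inter> C) \<le> Suc 0" if "C \<in> Chains r" for C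
    proof (subst card_le_Suc0_iff_eq)
      show "\<forall>x\<in>S \<inter> C. \<forall>y\<in>S \<inter> C. x = y"
        using S'(2) that by (fastforce simp: Chains_def)
    qed (use fin in simp)
    have "(S \<inter> A) \<union> (S \<inter> B) = S" using S'(1) assms(4) by auto
    then have "card S \<le> card (S \<inter> A) + card (S \<inter> B)"
      using card_Un_le[of "S \<inter> A" "S \<inter> B"] by simp
    then show ?thesis using le1[OF assms(2)] le1[OF assms(3)] by simp
  qed
  moreover have "finite {S. antichain V r S}"
    by (rule finite_subset[of _ "Pow V"]) (use assms(1) in \<open>auto simp: antichain_def\<close>)
  moreover have "{} \<in> {S. antichain V r S}" by (simp add: antichain_def)
  ultimately show ?thesis unfolding poset_width_def by (subst Max_le_iff) auto
qed

text \<open>The known order on \<open>B\<close> is added to \<open>r\<close>, which leaves a poset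
  covered by the chains \<open>A\<close> and \<open>B\<close>. It extends \<open>r\<close>, so it
  has no more linear extensions than \<open>r\<close>.\<close>

lemma sortable_within_two_chains:
  fixes M :: "'a comparison_algorithm" and V :: "'a set"
  assumes M: "solves_merging M"
      "\<And>V r l. finite V \<Longrightarrow> partial_order_on V r \<Longrightarrow> poset_width V r \<le> 2 \<Longrightarrow>
        l \<in> linear_extensions V r \<Longrightarrow>
        real (comparisons l (M V r)) \<le> c * log 2 (real (num_linear_extensions V r))"
    and c: "c \<ge> 0"
    and V: "finite V" and A: "A \<in> Chains r" and AB: "V \<subseteq> A \<union> B" "B \<subseteq> V"
    and L: "L \<subseteq> linear_extensions V r" "sorted_by_all L B"
  shows "sortable_within V L (c * log 2 (real (num_linear_extensions V r)))"
proof (cases "L = {}")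
  case True
  then show ?thesis by (simp add: sortable_within_empty)
next
  case False
  then obtain l0 where l0: "l0 \<in> L" by auto
  \<comment> \<open>All candidates agree with \<open>l0\<close> on \<open>B\<close> and are
    transitive, so each contains this closure. Being contained in \<open>l0\<close> also makes it
    antisymmetric.\<close>
  define r' where "r' = (r \<union> l0 \<inter> B \<times> B)\<^sup>+"
  have sub: "r' \<subseteq> l" if "l \<in> L" for l
  proof -
    have l: "r \<subseteq> l" "trans l" using that L(1) by (auto simp: linear_extensions_def order_on_defs)
    have "r \<union> l0 \<inter> B \<times> B \<subseteq> l"
      using l(1) L(2) l0 that by (auto simp: sorted_by_all_def)
    then show ?thesis
      unfolding r'_def using trancl_mono_subset[of "r \<union> l0 \<inter> B \<times> B" l] l(2) by simp
  qed
  have l0': "l0 \<subseteq> V \<times> V" "refl_on V l0" "antisym l0" "total_on V l0" "r \<subseteq> l0"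
    using l0 L(1) by (auto simp: linear_extensions_def order_on_defs)
  have step: "p \<in> r'" if "p \<in> r \<union> l0 \<inter> B \<times> B" for p
    unfolding r'_def using that by (cases p) auto
  have rr': "r \<subseteq> r'" using step by auto
  have A': "A \<in> Chains r'" using A mono_Chains[OF rr'] by auto
  have B': "B \<in> Chains r'"
    unfolding Chains_def
  proof (intro CollectI ballI)
    fix x y assume "x \<in> B" "y \<in> B"
    then show "(x, y) \<in> r' \<or> (y, x) \<in> r'"
      using l0'(2,4) AB(2) step[of "(x, y)"] step[of "(y, x)"]
      by (cases "x = y") (auto simp: total_on_def refl_on_def)
  qed
  have "refl_on V r'"
    unfolding refl_on_def
  proof
    fix x assume "x \<in> V"
    then have "x \<in> A \<or> x \<in> B" using AB(1) by auto
    then show "(x, x) \<in> r'" using A' B' by (auto simp: Chains_def)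
  qed
  moreover have "antisym r'" "r' \<subseteq> V \<times> V" "trans r'"
    using sub[OF l0] l0' unfolding r'_def by (auto intro: antisym_subset)
  ultimately have r': "partial_order_on V r'" by (simp add: order_on_defs)
  have width: "poset_width V r' \<le> 2" by (rule poset_width_le_2[OF V A' B' AB(1)])
  have L': "L \<subseteq> linear_extensions V r'" using L(1) sub by (auto simp: linear_extensions_def)
  then have "num_linear_extensions V r' > 0"
    using l0 finite_linear_extensions[OF V, of r'] by (auto simp: num_linear_extensions_def card_gt_0_iff)
  then have "log 2 (real (num_linear_extensions V r')) \<le> log 2 (real (num_linear_extensions V r))"
    using num_linear_extensions_antimono[OF V rr'] by simp
  then have le: "c * log 2 (real (num_linear_extensions V r')) \<le> c * log 2 (real (num_linear_extensions V r))"
    using c by (rule mult_left_mono)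
  have "sorts V r' (M V r')" using M(1) V r' width by (simp add: solves_merging_def)
  then show ?thesis
    unfolding sortable_within_def sorts_def
    using order_trans[OF M(2)[OF V r' width] le] L' by (intro exI[of _ "M V r'"]) blast
qed

lemma sortable_within_linear_extensions:
  fixes M :: "'a comparison_algorithm" and V :: "'a set"
  assumes M: "solves_merging M"
      "\<And>V r l. finite V \<Longrightarrow> partial_order_on V r \<Longrightarrow> poset_width V r \<le> 2 \<Longrightarrow>
        l \<in> linear_extensions V r \<Longrightarrow>
        real (comparisons l (M V r)) \<le> c * log 2 (real (num_linear_extensions V r))"
    and c: "c \<ge> 0"
    and V: "finite V" "partial_order_on V r"
  shows "sortable_within V (linear_extensions V r)
           ((9 + c) * log 2 (real (num_linear_extensions V r)))"
proof -
  let ?e = "log 2 (real (num_linear_extensions V r))"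
  have rV: "r \<subseteq> V \<times> V" and refl: "\<And>x. x \<in> V \<Longrightarrow> (x, x) \<in> r"
    using V(2) by (auto simp: order_on_defs refl_on_def)
  have ChV: "C \<subseteq> V" if "C \<in> Chains r" for C using that rV by (auto simp: Chains_def)
  have fin: "finite (Chains r)"
    by (rule finite_subset[of _ "Pow V"]) (use ChV V(1) in auto)
  have "{} \<in> Chains r" by (simp add: Chains_def)
  then have "Max (card ` Chains r) \<in> card ` Chains r" using fin by (intro Max_in) auto
  then obtain A where A: "A \<in> Chains r" "Max (card ` Chains r) = card A" by auto
  have longest: "card C \<le> card A" if "C \<in> Chains r" for C
    unfolding A(2)[symmetric] by (rule Max_ge) (use that fin in auto)
  define B where "B = V - A"
  define s where "s = r \<inter> B \<times> B"
  have B: "B \<subseteq> V" "finite B" "V \<subseteq> A \<union> B" "partial_order_on B s"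
    using V(1) partial_order_on_restrict[OF V(2)] by (auto simp: B_def s_def)
  have cardB: "card B = card V - card A"
    unfolding B_def using ChV[OF A(1)] V(1) by (meson card_Diff_subset finite_subset)
  have p: "2 ^ card B \<le> num_linear_extensions V r"
    unfolding cardB by (rule two_power_le_num_linear_extensions[OF V longest])
  then have "log 2 (2 ^ card B) \<le> ?e"
    by (intro log_le_cancel_iff[THEN iffD2]) (auto simp: numeral_power_le_of_nat_cancel_iff intro: less_le_trans[of 0 "2 ^ card B"])
  then have B_le: "real (card B) \<le> ?e" by (simp add: log_nat_power)
  have s_le: "log 2 (num_linear_extensions B s) \<le> ?e"
  proof -
    \<comment> \<open>With the trivial chain bound \<open>card B\<close> the power of two is 1,
      which shows that \<open>s\<close> has a linear extension and that its logarithm is monotone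
      here.\<close>
    have "card C \<le> card B" if "C \<in> Chains s" for C
      by (rule card_mono[OF B(2)]) (use that in \<open>auto simp: Chains_def s_def\<close>)
    then have "1 \<le> num_linear_extensions B s"
      using two_power_le_num_linear_extensions[OF B(2,4), of "card B"] by simp
    then show ?thesis using num_linear_extensions_restrict_le[OF V B(1)] by (simp add: s_def)
  qed
  have refl_s: "(x, x) \<in> s" if "x \<in> B" for x using that refl B(1) by (auto simp: s_def)
  obtain P where P: "partition_on B P" "P \<subseteq> Chains s"
    "\<And>D t. D \<in> Chains s \<Longrightarrow> D \<subseteq> \<Union>{C\<in>P. card C \<le> t} \<Longrightarrow> card D \<le> t"
    using greedy_chain_partition[OF B(2) refl_s] by metis
  \<comment> \<open>These are Shannon code lengths for the distribution
    \<open>card C / card B\<close>: rounding up preserves Kraft's inequality and costs at most one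
    comparison per element.\<close>
  define d where "d C = nat \<lceil>log 2 (card B / card C)\<rceil>" for C :: "'a set"
  have PB: "C \<subseteq> B" "finite C" "card C > 0" "card C \<le> card B" if "C \<in> P" for C
  proof -
    show CB: "C \<subseteq> B" using that P(1) by (auto simp: partition_on_def)
    then show "finite C" using B(2) by (rule finite_subset)
    then show "card C > 0" using that P(1) by (auto simp: partition_on_def card_gt_0_iff)
    show "card C \<le> card B" using CB B(2) by (rule card_mono[rotated])
  qed
  have cardP: "(\<Sum>C\<in>P. card C) = card B"
    using card_Union_disjoint[of P] P(1) PB(2) by (simp add: partition_on_def)
  have finP: "finite P" by (rule finite_elements[OF B(2) P(1)])
  have d_le: "real (d C) \<le> log 2 (card B / card C) + 1" if "C \<in> P" for C
  proof -
    have "0 \<le> log 2 (card B / card C)" using PB[OF that] by simp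
    then show ?thesis unfolding d_def by linarith
  qed
  have d_ge: "(1/2) ^ d C \<le> real (card C) / real (card B)" if "C \<in> P" for C
  proof -
    have pos: "real (card B) / real (card C) > 0" using PB[OF that] by simp
    have "log 2 (card B / card C) \<le> d C" unfolding d_def by linarith
    then have "real (card B) / real (card C) \<le> 2 ^ d C"
      using pos by (simp add: log_le_iff powr_realpow)
    then show ?thesis using PB[OF that] by (simp add: power_one_over field_simps)
  qed
  have "(\<Sum>C\<in>P. (1/2) ^ d C) \<le> (\<Sum>C\<in>P. real (card C) / real (card B))"
    by (rule sum_mono) (rule d_ge)
  also have "\<dots> = real (card B) / real (card B)"
    by (simp flip: cardP sum_divide_distrib)
  \<comment> \<open>Only an inequality, because the quotient is 0 when \<open>B\<close> is
    empty.\<close>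
  also have "\<dots> \<le> 1" by simp
  finally have kraft: "(\<Sum>C\<in>P. (1/2::real) ^ d C) \<le> 1" .
  have "sortable_within V (linear_extensions V r) (c * ?e + (\<Sum>C\<in>P. real (card C * d C)))"
  proof (rule kraft_merge_within[OF finP _ kraft])
    fix C assume C: "C \<in> P"
    have "C \<in> Chains r" using C P(2) by (auto simp: Chains_def s_def)
    then show "finite C \<and> C \<subseteq> V \<and> sorted_by_all (linear_extensions V r) C"
      using PB[OF C] B(1) sorted_by_all_Chains by blast
  next
    fix L assume "L \<subseteq> linear_extensions V r" "sorted_by_all L (\<Union>C\<in>P. C)"
    moreover have "(\<Union>C\<in>P. C) = B" using P(1) by (simp add: partition_on_def)
    ultimately show "sortable_within V L (c * ?e)"
      using sortable_within_two_chains[OF M c V(1) A(1) B(3,1)] by simp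
  qed (auto simp: linear_extensions_def)
  moreover have "(\<Sum>C\<in>P. real (card C * d C)) \<le> 9 * ?e"
  proof -
    have "(\<Sum>C\<in>P. real (card C * d C)) \<le> (\<Sum>C\<in>P. real (card C) * (log 2 (card B / card C) + 1))"
      unfolding of_nat_mult by (intro sum_mono mult_left_mono d_le) auto
    also have "\<dots> = (\<Sum>C\<in>P. real (card C) * log 2 (card B / card C)) + real (card B)"
      by (simp add: distrib_left sum.distrib flip: cardP)
    \<comment> \<open>The constant is \<open>9 = 2 + 6 + 1\<close>: the entropy bound gives 2 and 6,
      and rounding the depths up gives 1.\<close>
    also have "\<dots> \<le> 2 * log 2 (num_linear_extensions B s) + 6 * card B + card B"
      using greedy_entropy_le[OF B(2,4) P] by simp
    also have "\<dots> \<le> 9 * ?e" using B_le s_le by simp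
    finally show ?thesis .
  qed
  ultimately show ?thesis by (elim sortable_within_mono) (simp add: algebra_simps)
qed

theorem theorem6p1:
  fixes c3 :: real
  assumes "c3 \<ge> 0"
    and "\<exists>M :: 'a comparison_algorithm. solves_merging M \<and>
           (\<forall>V r. finite V \<and> partial_order_on V r \<and> poset_width V r \<le> 2 \<longrightarrow>
              (\<forall>l\<in>linear_extensions V r.
                 real (comparisons l (M V r)) \<le> c3 * log 2 (real (num_linear_extensions V r))))"
  shows "\<exists>A :: 'a comparison_algorithm. solves_sorting A \<and>
           (\<forall>V r. finite V \<and> partial_order_on V r \<longrightarrow>
              (\<forall>l\<in>linear_extensions V r.
                 real (comparisons l (A V r))
                   \<le> (9.09 + c3) * log 2 (real (num_linear_extensions V r))))"
proof -
  obtain M :: "'a comparison_algorithm" where M: "solves_merging M"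
    "\<And>V r l. finite V \<Longrightarrow> partial_order_on V r \<Longrightarrow> poset_width V r \<le> 2 \<Longrightarrow>
        l \<in> linear_extensions V r \<Longrightarrow>
        real (comparisons l (M V r)) \<le> c3 * log 2 (real (num_linear_extensions V r))"
    using assms(2) by blast
  let ?ok = "\<lambda>V r T. queries_within V T \<and> (\<forall>l\<in>linear_extensions V r.
    run l T = l \<and> real (comparisons l T) \<le> (9 + c3) * log 2 (real (num_linear_extensions V r)))"
  \<comment> \<open>An algorithm is any function from posets to trees, so one good tree may be
    chosen separately for each input.\<close>
  define A where "A V r = (SOME T. ?ok V r T)" for V :: "'a set" and r
  have A: "?ok V r (A V r)" if "finite V" "partial_order_on V r" for V r
    unfolding A_def
    by (rule someI_ex, fold sortable_within_def)
      (rule sortable_within_linear_extensions[OF M assms(1) that])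
  \<comment> \<open>Passing from 9 to 9.09 needs a nonnegative logarithm, and \<open>l\<close>
    witnesses that there is at least one linear extension.\<close>
  have le: "(9 + c3) * log 2 (real (num_linear_extensions V r))
      \<le> (9.09 + c3) * log 2 (real (num_linear_extensions V r))"
    if "finite V" "l \<in> linear_extensions V r" for V :: "'a set" and r l
  proof (rule mult_right_mono)
    have "num_linear_extensions V r > 0"
      using that finite_linear_extensions[OF that(1), of r]
      by (auto simp: num_linear_extensions_def card_gt_0_iff)
    then show "0 \<le> log 2 (real (num_linear_extensions V r))" by simp
  qed simp
  have "real (comparisons l (A V r)) \<le> (9.09 + c3) * log 2 (real (num_linear_extensions V r))"
    if "finite V" "partial_order_on V r" "l \<in> linear_extensions V r" for V r l
    by (rule order_trans[OF _ le[OF that(1,3)]]) (use A[OF that(1,2)] that(3) in blast)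
  moreover have "solves_sorting A"
    using A by (simp add: solves_sorting_def sorts_def)
  ultimately show ?thesis by blast
qed

end
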